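(* Let $G$ be a connected graph. Then $tmc(G)=5$ if and only if either $G$ is a tree with $l(G)=4$, or $G$ is a unicyclic graph with $l(G)=3$.
   Context: All graphs are simple, finite and undirected; $n$ and $m$ denote the number of vertices and edges. A graph is total-colored if all its edges and all its vertices are assigned colors. A path in a total-colored graph is a total monochromatic path if all its edges and all its internal vertices have the same color. A total-coloring is a TMC-coloring if any two vertices are connected by a total monochromatic path. For a connected graph $G$, $tmc(G)$ is the maximum number of colors used in a TMC-coloring of $G$. For a tree $T$, $l(T)$ is its number of leaves (vertices of degree one), and for a connected graph $G$, $l(G)=\max\{l(T): T \text{ a spanning tree of } G\}$. A connected graph is unicyclic if $m=n$. (The paper lists the unicyclic graphs with $l(G)=3$ as the families $\mathcal{G}_1,\dots,\mathcal{G}_4$ drawn in a figure captioned "Unicyclic graphs with $l(G)=3$".) *)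

theory Defs
  imports Main
begin

locale simple_graph =
  fixes V :: "'a set" and E :: "'a set set"
  assumes finite_vertices: "finite V"
    and edges: "e \<in> E \<Longrightarrow> \<exists>u\<in>V. \<exists>v\<in>V. u \<noteq> v \<and> e = {u, v}"

text \<open>A path is given by its list of vertices.\<close>

fun path_edges :: "'a list \<Rightarrow> 'a set list" where
  "path_edges (u # v # xs) = {u, v} # path_edges (v # xs)"
| "path_edges _ = []"

definition internal_vertices :: "'a list \<Rightarrow> 'a list" where
  "internal_vertices xs = butlast (tl xs)"

definition graph_path :: "'a set \<Rightarrow> 'a set set \<Rightarrow> 'a \<Rightarrow> 'a list \<Rightarrow> 'a \<Rightarrow> bool" where
  "graph_path V E u xs v \<longleftrightarrow>
     xs \<noteq> [] \<and> hd xs = u \<and> last xs = v \<and> distinct xs \<and>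
     set xs \<subseteq> V \<and> set (path_edges xs) \<subseteq> E"

definition connected_graph :: "'a set \<Rightarrow> 'a set set \<Rightarrow> bool" where
  "connected_graph V E \<longleftrightarrow> V \<noteq> {} \<and> (\<forall>u\<in>V. \<forall>v\<in>V. \<exists>xs. graph_path V E u xs v)"

definition graph_cycle :: "'a set \<Rightarrow> 'a set set \<Rightarrow> 'a list \<Rightarrow> bool" where
  "graph_cycle V E xs \<longleftrightarrow>
     length xs \<ge> 3 \<and> graph_path V E (hd xs) xs (last xs) \<and> {last xs, hd xs} \<in> E"

definition is_tree :: "'a set \<Rightarrow> 'a set set \<Rightarrow> bool" where
  "is_tree V E \<longleftrightarrow> connected_graph V E \<and> \<not> (\<exists>xs. graph_cycle V E xs)"

definition unicyclic :: "'a set \<Rightarrow> 'a set set \<Rightarrow> bool" where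
  "unicyclic V E \<longleftrightarrow> connected_graph V E \<and> card E = card V"

definition degree :: "'a set set \<Rightarrow> 'a \<Rightarrow> nat" where
  "degree E v = card {e \<in> E. v \<in> e}"

definition num_leaves :: "'a set \<Rightarrow> 'a set set \<Rightarrow> nat" where
  "num_leaves V T = card {v \<in> V. degree T v = 1}"

text \<open>A spanning tree of \<open>(V, E)\<close> is given by its edge set \<open>T \<subseteq> E\<close>.\<close>

definition max_leaves :: "'a set \<Rightarrow> 'a set set \<Rightarrow> nat" where
  "max_leaves V E = Max {num_leaves V T | T. T \<subseteq> E \<and> is_tree V T}"

text \<open>
  A total-coloring is a pair of a vertex coloring \<open>cv\<close> and an edge coloring \<open>ce\<close> drawing on
  the same colors; only the values on \<open>V\<close> and \<open>E\<close> matter.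
\<close>

definition total_mono_path ::
    "'a set \<Rightarrow> 'a set set \<Rightarrow> ('a \<Rightarrow> nat) \<Rightarrow> ('a set \<Rightarrow> nat) \<Rightarrow> 'a \<Rightarrow> 'a list \<Rightarrow> 'a \<Rightarrow> bool" where
  "total_mono_path V E cv ce u xs v \<longleftrightarrow>
     graph_path V E u xs v \<and>
     (\<exists>k. (\<forall>e \<in> set (path_edges xs). ce e = k) \<and>
          (\<forall>w \<in> set (internal_vertices xs). cv w = k))"

definition tmc_coloring ::
    "'a set \<Rightarrow> 'a set set \<Rightarrow> ('a \<Rightarrow> nat) \<Rightarrow> ('a set \<Rightarrow> nat) \<Rightarrow> bool" where
  "tmc_coloring V E cv ce \<longleftrightarrow>
     (\<forall>u\<in>V. \<forall>v\<in>V. \<exists>xs. total_mono_path V E cv ce u xs v)"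

definition tmc :: "'a set \<Rightarrow> 'a set set \<Rightarrow> nat" where
  "tmc V E = Max {card (cv ` V \<union> ce ` E) | cv ce. tmc_coloring V E cv ce}"

end

theory Submission
  imports Defs
begin

text \<open>
  Write \<open>n\<close>, \<open>m\<close>, \<open>l\<close> for the numbers of vertices, edges and maximal leaves.  Giving one color
  to the edges and inner vertices of a spanning tree with \<open>l\<close> leaves and fresh colors to everything
  else shows \<open>tmc \<ge> m - n + 2 + l\<close>.  Conversely, suppose some vertex \<open>y\<close> reaches all others by
  monochromatic paths in its own color \<open>c\<close>.  Then there is a spanning tree with edges of color
  \<open>c\<close> in which every vertex of another color is a leaf, so at most \<open>m - n + 2 + l\<close> colors occur.
  The neighbor of a pendant vertex is always such a \<open>y\<close> if \<open>n \<ge> 3\<close>.  In a 2-regular graph with two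
  nonadjacent vertices, so is any internal vertex of a monochromatic path between them, because
  that path already determines the color of both edges at \<open>y\<close>.

  If \<open>m > n\<close>, a vertex of degree at least 3 gives \<open>l \<ge> 3\<close>, hence \<open>tmc \<ge> 6\<close>.  If \<open>m \<le> n\<close>, either there
  is a pendant vertex and \<open>tmc = m - n + 2 + l\<close>, or the graph is 2-regular with \<open>l = 2\<close>; then
  \<open>tmc \<le> 4\<close>, except for the triangle, where \<open>tmc = 6\<close>.
\<close>

subsection \<open>Paths and reachability\<close>

text \<open>Reachability as \<open>(adj E)\<^sup>*\<close> does not insist on distinct vertices, so
  it composes by transitivity, unlike \<open>graph_path\<close>.\<close>

definition adj :: "'a set set \<Rightarrow> ('a \<times> 'a) set" where
  "adj E = {(u, v). {u, v} \<in> E}"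

lemma adj_sym: "(u, v) \<in> (adj E)\<^sup>* \<Longrightarrow> (v, u) \<in> (adj E)\<^sup>*"
proof -
  have "sym (adj E)" by (auto simp: adj_def sym_def insert_commute)
  then show "(u, v) \<in> (adj E)\<^sup>* \<Longrightarrow> (v, u) \<in> (adj E)\<^sup>*" by (meson sym_rtrancl symD)
qed

lemma adj_mono: "T \<subseteq> E \<Longrightarrow> (u, v) \<in> (adj T)\<^sup>* \<Longrightarrow> (u, v) \<in> (adj E)\<^sup>*"
  by (rule subsetD[OF rtrancl_mono]) (auto simp: adj_def)

lemma path_edges_append: "set (path_edges ys) \<subseteq> set (path_edges (xs @ ys))"
proof (induction xs)
  case (Cons x xs)
  then show ?case by (cases "xs @ ys") auto
qed simp

lemma path_edges_subset: "e \<in> set (path_edges xs) \<Longrightarrow> e \<subseteq> set xs"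
  by (induction xs rule: path_edges.induct) auto

lemma path_edges_snoc:
  "path_edges (xs @ [a, b]) = path_edges (xs @ [a]) @ [{a, b}]"
  by (induction xs rule: path_edges.induct) auto

text \<open>Ensures that deleting the closing edge of a cycle leaves its path intact. On two
  vertices the closing edge would be the path itself, hence the length bound.\<close>

lemma path_edges_first_last:
  assumes "distinct xs" "length xs \<ge> 3"
  shows "{last xs, hd xs} \<notin> set (path_edges xs)"
proof -
  obtain a b c ys where xs: "xs = a # b # c # ys"
    using assms(2) by (metis One_nat_def Suc_le_length_iff numeral_3_eq_3)
  have "last xs \<noteq> a" "last xs \<noteq> b" using assms(1) unfolding xs by auto
  moreover have "{last xs, a} \<notin> set (path_edges (b # c # ys))"
    using path_edges_subset[of _ "b # c # ys"] assms(1) unfolding xs by auto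
  ultimately show ?thesis unfolding xs by (auto simp: doubleton_eq_iff)
qed

lemma internal_vertex_split:
  assumes "w \<in> set (internal_vertices xs)"
  obtains as a b bs where "xs = as @ a # w # b # bs"
proof -
  obtain x ys where xs: "xs = x # ys" using assms by (cases xs) (auto simp: internal_vertices_def)
  obtain zs z where ys: "ys = zs @ [z]"
    using assms xs by (cases ys rule: rev_cases) (auto simp: internal_vertices_def)
  have "w \<in> set zs" using assms by (simp add: xs ys internal_vertices_def)
  then obtain ps qs where zs: "zs = ps @ w # qs" by (meson split_list)
  have "\<exists>as a. x # ps = as @ [a]" by (metis append_butlast_last_id list.distinct(1))
  then obtain as a where 1: "x # ps = as @ [a]" by blast
  obtain b bs where 2: "qs @ [z] = b # bs" by (cases "qs @ [z]") auto
  have "xs = (x # ps) @ w # (qs @ [z])" by (simp add: xs ys zs)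
  then show thesis using that 1 2 by simp
qed

lemma path_edges_around:
  "{a, w} \<in> set (path_edges (as @ a # w # b # bs))"
  "{w, b} \<in> set (path_edges (as @ a # w # b # bs))"
  using path_edges_append[of "a # w # b # bs" as] by auto

text \<open>Serves both bounds: it shows that internal vertices of tree paths are not leaves, and it
  transfers the color of a monochromatic path to two edges at an internal vertex.\<close>

lemma graph_path_edges_around:
  assumes "graph_path V E u xs v" "w \<in> set (internal_vertices xs)"
  obtains a b where "a \<noteq> b" "a \<noteq> w" "b \<noteq> w" "{a, w} \<in> E" "{b, w} \<in> E"
    "{a, w} \<in> set (path_edges xs)" "{b, w} \<in> set (path_edges xs)"
proof -
  obtain as a b bs where xs: "xs = as @ a # w # b # bs"
    using internal_vertex_split[OF assms(2)] .
  have e: "{a, w} \<in> set (path_edges xs)" "{b, w} \<in> set (path_edges xs)"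
    using path_edges_around[of a w as b bs] path_edges_around(2)[of w b as a bs]
    by (simp_all add: xs insert_commute)
  moreover have "{a, w} \<in> E" "{b, w} \<in> E" using e assms(1) by (auto simp: graph_path_def)
  moreover have "a \<noteq> b" "a \<noteq> w" "b \<noteq> w" using assms(1) by (auto simp: graph_path_def xs)
  ultimately show thesis using that by blast
qed

lemma graph_path_imp_reachable:
  "graph_path V E u xs v \<Longrightarrow> (u, v) \<in> (adj E)\<^sup>*"
proof (induction xs arbitrary: u rule: path_edges.induct)
  case (1 a b xs)
  then have "graph_path V E b (b # xs) v" and "(u, b) \<in> adj E"
    by (auto simp: graph_path_def adj_def)
  then show ?case using 1 by (meson converse_rtrancl_into_rtrancl)
qed (auto simp: graph_path_def)

lemma graph_path_suffix:
  assumes "graph_path V E u (xs @ w # ys) v"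
  shows "graph_path V E w (w # ys) v"
  using assms path_edges_append[of "w # ys" xs] by (auto simp: graph_path_def)

lemma graph_path_mono:
  "graph_path V T u xs v \<Longrightarrow> T \<subseteq> E \<Longrightarrow> graph_path V E u xs v"
  by (auto simp: graph_path_def)

lemma degree_mono: "finite E \<Longrightarrow> T \<subseteq> E \<Longrightarrow> degree T v \<le> degree E v"
  unfolding degree_def by (rule card_mono) auto

lemma rtrancl_crossing:
  assumes "(s, x) \<in> R\<^sup>*" "s \<in> S" "x \<notin> S"
  obtains a b where "(a, b) \<in> R" "a \<in> S" "b \<notin> S"
proof -
  have "x \<notin> S \<longrightarrow> (\<exists>a b. (a, b) \<in> R \<and> a \<in> S \<and> b \<notin> S)"
    using assms(1) by (induction rule: rtrancl_induct) (use assms(2) in auto)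
  then show thesis using assms(3) that by blast
qed

context simple_graph
begin

lemma subgraph: "T \<subseteq> E \<Longrightarrow> simple_graph V T"
  using edges finite_vertices by unfold_locales blast+

lemma edge_subset: "e \<in> E \<Longrightarrow> e \<subseteq> V"
  using edges by blast

lemma card_edge: "e \<in> E \<Longrightarrow> card e = 2"
  using edges by fastforce

lemma edge_vertices: "{u, v} \<in> E \<Longrightarrow> u \<in> V \<and> v \<in> V \<and> u \<noteq> v"
  using edge_subset card_edge by fastforce

lemma edge_with: "e \<in> E \<Longrightarrow> v \<in> e \<Longrightarrow> \<exists>w. e = {v, w}"
  using edges by blast

lemma finite_edges: "finite E"
  using edge_subset finite_vertices by (meson PowI finite_Pow_iff finite_subset subsetI)

lemma reachable_imp_graph_path:
  assumes "(u, v) \<in> (adj E)\<^sup>*" "v \<in> V"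
  shows "\<exists>xs. graph_path V E u xs v"
  using assms
proof (induction rule: converse_rtrancl_induct)
  case base
  then show ?case by (intro exI[of _ "[v]"]) (simp add: graph_path_def)
next
  case (step u w)
  then obtain xs where xs: "graph_path V E w xs v" by blast
  have uw: "{u, w} \<in> E" using step by (simp add: adj_def)
  show ?case
  proof (cases "u \<in> set xs")
    case True
    \<comment> \<open>Prepending \<open>u\<close> would repeat it, so the path is cut back to its
      suffix starting at \<open>u\<close>.\<close>
    then obtain ps qs where "xs = ps @ u # qs" by (meson split_list)
    then show ?thesis using graph_path_suffix xs by metis
  next
    case False
    obtain ys where ys: "xs = w # ys" using xs by (cases xs) (auto simp: graph_path_def)
    have "graph_path V E u (u # xs) v"
      using xs uw False edge_vertices[OF uw] by (auto simp: graph_path_def ys)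
    then show ?thesis by blast
  qed
qed

lemma connected_iff:
  "connected_graph V E \<longleftrightarrow> V \<noteq> {} \<and> (\<forall>u\<in>V. \<forall>v\<in>V. (u, v) \<in> (adj E)\<^sup>*)"
  unfolding connected_graph_def
  using reachable_imp_graph_path graph_path_imp_reachable by metis

lemma connected_if_reachable:
  assumes "r \<in> V" "\<And>v. v \<in> V \<Longrightarrow> (r, v) \<in> (adj E)\<^sup>*"
  shows "connected_graph V E"
  using assms unfolding connected_iff by (metis adj_sym empty_iff rtrancl_trans)

subsection \<open>Degrees and spanning trees\<close>

text \<open>Double counting of incidences: each edge has exactly two ends.\<close>

lemma sum_degree: "(\<Sum>v\<in>V. degree E v) = 2 * card E"
proof -
  have "(\<Sum>v\<in>V. degree E v) = (\<Sum>v\<in>V. card {e \<in> E. v \<in> e})" by (simp add: degree_def)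
  also have "\<dots> = (\<Sum>e\<in>E. 2)"
  proof (rule sum_multicount_gen)
    show "\<forall>e\<in>E. card {v \<in> V. v \<in> e} = 2"
    proof
      fix e assume e: "e \<in> E"
      then have "{v \<in> V. v \<in> e} = e" using edge_subset by blast
      then show "card {v \<in> V. v \<in> e} = 2" using card_edge e by simp
    qed
  qed (use finite_vertices finite_edges in auto)
  finally show ?thesis by simp
qed

lemma degree_pos:
  assumes "connected_graph V E" "card V \<ge> 2" "v \<in> V"
  shows "degree E v \<ge> 1"
proof -
  obtain w where w: "w \<in> V" "w \<noteq> v"
    using assms(2,3) by (metis One_nat_def card_le_Suc0_iff_eq finite_vertices not_less_eq_eq numeral_2_eq_2)
  have "(v, w) \<in> (adj E)\<^sup>*" using assms w by (simp add: connected_iff)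
  then obtain b where "(v, b) \<in> adj E" using w by (metis converse_rtranclE)
  then have "{v, b} \<in> {e \<in> E. v \<in> e}" by (simp add: adj_def)
  then have "card {e \<in> E. v \<in> e} \<noteq> 0" using finite_edges by auto
  then show ?thesis by (simp add: degree_def)
qed

lemma degree_ge_2:
  assumes "{a, w} \<in> E" "{b, w} \<in> E" "a \<noteq> b"
  shows "degree E w \<ge> 2"
proof -
  have "card {{a, w}, {b, w}} \<le> degree E w"
    unfolding degree_def by (rule card_mono) (use assms finite_edges in auto)
  moreover have "{a, w} \<noteq> {b, w}" using assms(3) by (auto simp: doubleton_eq_iff)
  ultimately show ?thesis by simp
qed

lemma degree_eq_card_neighbours: "degree E v = card {w. {v, w} \<in> E}"
proof -
  have "{e \<in> E. v \<in> e} = (\<lambda>w. {v, w}) ` {w. {v, w} \<in> E}"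
    using edge_with by auto
  moreover have "inj_on (\<lambda>w. {v, w}) {w. {v, w} \<in> E}"
    by (auto simp: inj_on_def doubleton_eq_iff)
  ultimately show ?thesis by (simp add: degree_def card_image)
qed

text \<open>Induction on the number of vertices not yet reached: one edge leaving \<open>S\<close>
  adds one vertex and one edge, which preserves the count. The initial \<open>T\<close> is left
  arbitrary so that a star can be extended later; \<open>\<Union>T \<subseteq> S\<close> guarantees
  that the added edge is new.\<close>

lemma extend_to_spanning:
  assumes "connected_graph V E"
    and "S \<subseteq> V" "r \<in> S" "T \<subseteq> E" "\<Union>T \<subseteq> S" "card T + 1 = card S"
    and "\<And>v. v \<in> S \<Longrightarrow> (r, v) \<in> (adj T)\<^sup>*"
  shows "\<exists>T'. T \<subseteq> T' \<and> T' \<subseteq> E \<and> connected_graph V T' \<and> card T' + 1 = card V"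
  using assms(2-)
proof (induction "card (V - S)" arbitrary: S T)
  case 0
  then have "S = V" using finite_vertices by auto
  then have "connected_graph V T"
    using 0 simple_graph.connected_if_reachable[OF subgraph] by blast
  then show ?case using 0 \<open>S = V\<close> by blast
next
  case (Suc k)
  have "V - S \<noteq> {}" using Suc.hyps(2) by (metis card.empty nat.distinct(1))
  then obtain x where x: "x \<in> V" "x \<notin> S" by blast
  have "(r, x) \<in> (adj E)\<^sup>*" using assms(1) Suc.prems x by (auto simp: connected_iff)
  then obtain a b where ab: "(a, b) \<in> adj E" "a \<in> S" "b \<notin> S"
    using rtrancl_crossing x Suc.prems(2) by metis
  then have e: "{a, b} \<in> E" by (simp add: adj_def)
  let ?S = "insert b S" and ?T = "insert {a, b} T"
  have fin: "finite S" "finite T"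
    using Suc.prems finite_vertices finite_edges by (meson finite_subset)+
  have nT: "{a, b} \<notin> T" using Suc.prems(4) ab by auto
  have "b \<in> V" using edge_vertices[OF e] by simp
  have "V - ?S = (V - S) - {b}" by auto
  then have "card (V - ?S) = k" using Suc.hyps(2) \<open>b \<in> V\<close> ab(3) by simp
  moreover have "(r, v) \<in> (adj ?T)\<^sup>*" if "v \<in> ?S" for v
  proof -
    have *: "(r, v) \<in> (adj ?T)\<^sup>*" if "v \<in> S" for v
      using Suc.prems(6)[OF that] adj_mono by (metis subset_insertI)
    have "(a, b) \<in> adj ?T" by (simp add: adj_def)
    then show ?thesis using *[OF ab(2)] * that by (metis insertE rtrancl.rtrancl_into_rtrancl)
  qed
  ultimately have "\<exists>T'. ?T \<subseteq> T' \<and> T' \<subseteq> E \<and> connected_graph V T' \<and> card T' + 1 = card V"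
    using Suc.hyps(1)[of ?S ?T] Suc.prems e ab \<open>b \<in> V\<close> nT fin by fastforce
  then show ?case by blast
qed

lemma spanning_exists:
  assumes "connected_graph V E"
  shows "\<exists>T. T \<subseteq> E \<and> connected_graph V T \<and> card T + 1 = card V"
proof -
  obtain r where "r \<in> V" using assms by (auto simp: connected_iff)
  then show ?thesis using extend_to_spanning[OF assms, of "{r}" r "{}"] by auto
qed

lemma connected_card: "connected_graph V E \<Longrightarrow> card V \<le> card E + 1"
  using spanning_exists card_mono[OF finite_edges] by (metis add_le_cancel_right)

text \<open>The rest of the cycle is a detour around the deleted edge.\<close>

lemma connected_remove_cycle_edge:
  assumes "connected_graph V E" "graph_cycle V E xs"
  shows "connected_graph V (E - {{last xs, hd xs}})"
proof -
  let ?e = "{last xs, hd xs}" let ?F = "E - {?e}"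
  have p: "graph_path V E (hd xs) xs (last xs)" "length xs \<ge> 3"
    using assms(2) by (auto simp: graph_cycle_def)
  have "distinct xs" using p(1) by (simp add: graph_path_def)
  then have "?e \<notin> set (path_edges xs)" using path_edges_first_last p(2) by blast
  then have "graph_path V ?F (hd xs) xs (last xs)" using p by (auto simp: graph_path_def)
  then have r: "(hd xs, last xs) \<in> (adj ?F)\<^sup>*" by (rule graph_path_imp_reachable)
  have "adj E \<subseteq> (adj ?F)\<^sup>*"
  proof clarify
    fix u v assume uv: "(u, v) \<in> adj E"
    show "(u, v) \<in> (adj ?F)\<^sup>*"
    proof (cases "{u, v} = ?e")
      case True
      then show ?thesis using r adj_sym[OF r] by (auto simp: doubleton_eq_iff)
    next
      case False
      then show ?thesis using uv by (auto simp: adj_def)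
    qed
  qed
  then have "(adj E)\<^sup>* \<subseteq> (adj ?F)\<^sup>*" by (metis rtrancl_subset_rtrancl)
  moreover have "simple_graph V ?F" by (rule subgraph) auto
  ultimately show ?thesis using assms(1) by (auto simp: connected_iff simple_graph.connected_iff)
qed

text \<open>Forward: a spanning connected \<open>T\<close> with one edge fewer than vertices must be
  all of \<open>E\<close>, since a further edge would close a path of \<open>T\<close> to a cycle.
  Backward: removing a cycle edge would leave a connected graph with too few edges.\<close>

lemma is_tree_iff: "is_tree V E \<longleftrightarrow> connected_graph V E \<and> card E + 1 = card V"
proof
  assume t: "is_tree V E"
  then have c: "connected_graph V E" by (simp add: is_tree_def)
  obtain T where T: "T \<subseteq> E" "connected_graph V T" "card T + 1 = card V"
    using spanning_exists[OF c] by blast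
  have "e \<in> T" if e: "e \<in> E" for e
  proof (rule ccontr)
    assume nT: "e \<notin> T"
    obtain a b where ab: "a \<in> V" "b \<in> V" "a \<noteq> b" "e = {a, b}" using edges e by blast
    obtain xs where xs: "graph_path V T a xs b" using T(2) ab by (auto simp: connected_graph_def)
    \<comment> \<open>One vertex would force \<open>a = b\<close>, and two would put
      \<open>e\<close> into \<open>T\<close>.\<close>
    have "length xs \<ge> 3"
    proof (rule ccontr)
      assume "\<not> length xs \<ge> 3"
      then have "length xs = 0 \<or> length xs = 1 \<or> length xs = 2" by linarith
      then show False using xs ab nT
        by (auto simp: graph_path_def length_Suc_conv numeral_2_eq_2)
    qed
    moreover have "hd xs = a" "last xs = b" using xs by (auto simp: graph_path_def)
    ultimately have "graph_cycle V E xs"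
      using graph_path_mono[OF xs T(1)] e ab by (simp add: graph_cycle_def insert_commute)
    then show False using t by (auto simp: is_tree_def)
  qed
  then have "E = T" using T by blast
  then show "connected_graph V E \<and> card E + 1 = card V" using T by simp
next
  assume c: "connected_graph V E \<and> card E + 1 = card V"
  have "\<not> graph_cycle V E xs" for xs
  proof
    assume xs: "graph_cycle V E xs"
    have "connected_graph V (E - {{last xs, hd xs}})"
      using connected_remove_cycle_edge c xs by blast
    then have "card V \<le> card (E - {{last xs, hd xs}}) + 1"
      using simple_graph.connected_card[OF subgraph] by blast
    moreover have "{last xs, hd xs} \<in> E" using xs by (simp add: graph_cycle_def)
    ultimately show False using c finite_edges
      by (metis add.commute card_Diff1_less leD nat_add_left_cancel_less)
  qed
  then show "is_tree V E" using c by (simp add: is_tree_def)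
qed

lemma spanning_is_tree:
  "T \<subseteq> E \<Longrightarrow> connected_graph V T \<Longrightarrow> card T + 1 = card V \<Longrightarrow> is_tree V T"
  using simple_graph.is_tree_iff[OF subgraph] by blast

lemma spanning_card:
  "T \<subseteq> E \<Longrightarrow> is_tree V T \<Longrightarrow> card T + 1 = card V"
  using simple_graph.is_tree_iff[OF subgraph] by blast

section \<open>The maximal number of leaves\<close>

lemma finite_num_leaves: "finite {num_leaves V T | T. T \<subseteq> E \<and> is_tree V T}"
proof -
  have "{num_leaves V T | T. T \<subseteq> E \<and> is_tree V T} \<subseteq> num_leaves V ` Pow E" by auto
  then show ?thesis using finite_edges by (meson finite_Pow_iff finite_imageI finite_subset)
qed

lemma num_leaves_le_max_leaves:
  "T \<subseteq> E \<Longrightarrow> is_tree V T \<Longrightarrow> num_leaves V T \<le> max_leaves V E"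
  unfolding max_leaves_def by (rule Max_ge[OF finite_num_leaves]) blast

lemma max_leaves_attained:
  assumes "connected_graph V E"
  obtains T where "T \<subseteq> E" "is_tree V T" "num_leaves V T = max_leaves V E"
proof -
  have "{num_leaves V T | T. T \<subseteq> E \<and> is_tree V T} \<noteq> {}"
    using spanning_exists[OF assms] spanning_is_tree by blast
  from Max_in[OF finite_num_leaves this] obtain T
    where "T \<subseteq> E" "is_tree V T" "max_leaves V E = num_leaves V T"
    unfolding max_leaves_def by blast
  then show thesis using that by simp
qed

subsection \<open>Bounds on the number of colors\<close>

lemma card_colors_le: "card (cv ` V \<union> ce ` E) \<le> card V + card E"
  by (meson add_mono card_Un_le card_image_le finite_edges finite_vertices order_trans)

text \<open>Colors range over all of \<open>nat\<close>; bounding the counts by the number of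
  colored objects is what gives \<open>Max\<close> in \<open>tmc\<close> its meaning.\<close>

lemma finite_color_counts:
  "finite {card (cv ` V \<union> ce ` E) | cv ce. tmc_coloring V E cv ce}"
  by (rule finite_subset[of _ "{..card V + card E}"]) (use card_colors_le in auto)

lemma card_colors_le_tmc:
  "tmc_coloring V E cv ce \<Longrightarrow> card (cv ` V \<union> ce ` E) \<le> tmc V E"
  unfolding tmc_def by (rule Max_ge[OF finite_color_counts]) blast

lemma tmc_attained:
  assumes "connected_graph V E"
  obtains cv ce where "tmc_coloring V E cv ce" "card (cv ` V \<union> ce ` E) = tmc V E"
proof -
  \<comment> \<open>The constant coloring shows that the maximum is over a nonempty set.\<close>
  have "tmc_coloring V E (\<lambda>_. 0) (\<lambda>_. 0)"
    using assms by (auto simp: tmc_coloring_def total_mono_path_def connected_graph_def)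
  then have "{card (cv ` V \<union> ce ` E) | cv ce. tmc_coloring V E cv ce} \<noteq> {}" by blast
  from Max_in[OF finite_color_counts this] obtain cv ce
    where "tmc_coloring V E cv ce" "tmc V E = card (cv ` V \<union> ce ` E)"
    unfolding tmc_def by blast
  then show thesis using that by simp
qed

text \<open>Paths inside a spanning tree \<open>T\<close> never pass through its leaves, so leaves
  and edges outside \<open>T\<close> can have private colors. With the shared color this makes 1 + l
  + (m - (n - 1)) colors; the statement is additive to avoid truncated subtraction.\<close>

lemma tmc_ge:
  assumes "connected_graph V E" "card V \<ge> 2"
  shows "card E + 2 + max_leaves V E \<le> tmc V E + card V"
proof -
  obtain T where T: "T \<subseteq> E" "is_tree V T" "num_leaves V T = max_leaves V E"
    using max_leaves_attained[OF assms(1)] .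
  interpret T: simple_graph V T by (rule subgraph[OF T(1)])
  have cT: "card T + 1 = card V" using spanning_card T by blast
  define L where "L = {v \<in> V. degree T v = 1}"
  have fL: "finite L" unfolding L_def using finite_vertices by simp
  obtain f :: "'a \<Rightarrow> nat" where f: "inj_on f L"
    using finite_imp_inj_to_nat_seg[OF fL] by blast
  obtain g :: "'a set \<Rightarrow> nat" where g: "inj_on g (E - T)"
    using finite_imp_inj_to_nat_seg[of "E - T"] finite_edges by blast
  \<comment> \<open>Color 0 is shared; odd colors go to leaves and positive even ones to edges
    outside \<open>T\<close>, so the three kinds cannot collide.\<close>
  define cv where "cv = (\<lambda>v. if v \<in> L then 2 * f v + 1 else 0)"
  define ce where "ce = (\<lambda>e. if e \<in> T then 0 else 2 * g e + 2)"
  have "tmc_coloring V E cv ce"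
    unfolding tmc_coloring_def
  proof (intro ballI)
    fix u v assume "u \<in> V" "v \<in> V"
    then obtain xs where xs: "graph_path V T u xs v"
      using T(2) unfolding is_tree_def connected_graph_def by blast
    have "cv w = 0" if w: "w \<in> set (internal_vertices xs)" for w
    proof -
      have "degree T w \<ge> 2"
        using graph_path_edges_around[OF xs w] T.degree_ge_2 by metis
      then show ?thesis by (simp add: cv_def L_def)
    qed
    moreover have "ce e = 0" if "e \<in> set (path_edges xs)" for e
      using that xs by (auto simp: graph_path_def ce_def)
    ultimately show "\<exists>xs. total_mono_path V E cv ce u xs v"
      using graph_path_mono[OF xs T(1)] by (auto simp: total_mono_path_def)
  qed
  then have "card (cv ` V \<union> ce ` E) \<le> tmc V E" by (rule card_colors_le_tmc)
  moreover have "card ({0} \<union> (cv ` L \<union> ce ` (E - T))) \<le> card (cv ` V \<union> ce ` E)"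
  proof (rule card_mono)
    \<comment> \<open>Color 0 must really occur, even if every vertex is a leaf; an edge of
      \<open>T\<close> provides it.\<close>
    have "T \<noteq> {}" using cT assms(2) by auto
    then obtain e where "e \<in> T" by blast
    then have "0 \<in> ce ` E" using T(1) by (force simp: ce_def)
    then show "{0} \<union> (cv ` L \<union> ce ` (E - T)) \<subseteq> cv ` V \<union> ce ` E"
      by (auto simp: L_def)
  qed (use finite_vertices finite_edges in auto)
  moreover have "card ({0} \<union> (cv ` L \<union> ce ` (E - T))) = 1 + (card L + card (E - T))"
  proof -
    have "card (cv ` L) = card L"
      by (rule card_image) (use f in \<open>auto simp: inj_on_def cv_def\<close>)
    moreover have "card (ce ` (E - T)) = card (E - T)"
      by (rule card_image) (use g in \<open>auto simp: inj_on_def ce_def\<close>)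
    moreover have "cv ` L \<inter> ce ` (E - T) = {}"
      by (auto simp: cv_def ce_def) presburger
    moreover have "{0} \<inter> (cv ` L \<union> ce ` (E - T)) = {}"
      by (auto simp: cv_def ce_def)
    ultimately show ?thesis using fL finite_edges by (simp add: card_Un_disjoint)
  qed
  moreover have "card L = max_leaves V E" using T(3) by (simp add: num_leaves_def L_def)
  moreover have "card (E - T) + card T = card E"
    using T(1) finite_edges by (metis Nat.add_diff_assoc2 T.finite_edges add_diff_cancel_right' card_Diff_subset card_mono)
  ultimately show ?thesis using cT by linarith
qed

text \<open>The color \<open>c\<close> covers all of \<open>C\<close> and \<open>T\<close>, so at
  most 1 + \<open>card (V - C)\<close> + \<open>card (E - T)\<close> colors occur, and vertices
  outside \<open>C\<close> are leaves of \<open>T\<close>.\<close>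

lemma colors_le_if_rooted:
  assumes "card V \<ge> 2" "y \<in> V" "cv y = c"
    and paths: "\<And>z. z \<in> V \<Longrightarrow> z \<noteq> y \<Longrightarrow> \<exists>xs. graph_path V E y xs z \<and>
        (\<forall>e \<in> set (path_edges xs). ce e = c) \<and> (\<forall>w \<in> set (internal_vertices xs). cv w = c)"
  shows "card (cv ` V \<union> ce ` E) + card V \<le> card E + 2 + max_leaves V E"
proof -
  define C where "C = {v \<in> V. cv v = c}"
  have y: "y \<in> C" using assms by (simp add: C_def)
  \<comment> \<open>The path is cut before its last edge: all vertices preceding \<open>z\<close>
    are \<open>y\<close> or internal, hence in \<open>C\<close>.\<close>
  have split: "\<exists>xs p. graph_path V E y (xs @ [p, z]) z \<and> set (xs @ [p]) \<subseteq> C \<and>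
      (\<forall>e \<in> set (path_edges (xs @ [p, z])). ce e = c)"
    if z: "z \<in> V" "z \<noteq> y" for z
  proof -
    obtain zs where zs: "graph_path V E y zs z" "\<forall>e \<in> set (path_edges zs). ce e = c"
      "\<forall>w \<in> set (internal_vertices zs). cv w = c" using paths[OF z] by blast
    obtain ws where ws: "zs = y # ws @ [z]"
    proof (cases zs rule: rev_cases)
      case (snoc us x)
      then show thesis using zs(1) z that by (cases us) (auto simp: graph_path_def)
    qed (use zs(1) in \<open>simp add: graph_path_def\<close>)
    have "set (y # ws) \<subseteq> C" using zs(1,3) y
      by (auto simp: C_def ws graph_path_def internal_vertices_def)
    moreover obtain xs p where "y # ws = xs @ [p]" by (metis append_butlast_last_id list.distinct(1))
    moreover have "zs = (y # ws) @ [z]" using ws by simp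
    ultimately show ?thesis using zs by (intro exI[of _ xs] exI[of _ p]) simp
  qed
  \<comment> \<open>The vertex just before \<open>z\<close> on a path from \<open>y\<close> becomes
    its parent.\<close>
  have "\<exists>p. p \<in> C \<and> {p, z} \<in> E \<and> ce {p, z} = c" if z: "z \<in> V - C" for z
  proof -
    have "z \<noteq> y" using z y by blast
    then obtain xs p where "graph_path V E y (xs @ [p, z]) z" "p \<in> C"
      "\<forall>e \<in> set (path_edges (xs @ [p, z])). ce e = c" using split[of z] z by auto
    then show ?thesis by (auto simp: graph_path_def path_edges_snoc)
  qed
  then obtain par where par: "\<And>z. z \<in> V - C \<Longrightarrow> par z \<in> C \<and> {par z, z} \<in> E \<and> ce {par z, z} = c"
    by metis
  \<comment> \<open>Keeping a single edge at each vertex outside \<open>C\<close> forces it to be a leaf of every spanning tree of \<open>H\<close>.\<close>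
  define H where "H = {e \<in> E. e \<subseteq> C \<and> ce e = c} \<union> (\<lambda>z. {par z, z}) ` (V - C)"
  have HE: "H \<subseteq> E" and Hc: "\<And>e. e \<in> H \<Longrightarrow> ce e = c" using par by (auto simp: H_def)
  interpret H: simple_graph V H by (rule subgraph[OF HE])
  have reachC: "(y, z) \<in> (adj H)\<^sup>*" if z: "z \<in> C" for z
  proof (cases "z = y")
    case False
    have "z \<in> V" using z by (simp add: C_def)
    then obtain xs p where xs: "graph_path V E y (xs @ [p, z]) z" "set (xs @ [p]) \<subseteq> C"
      "\<forall>e \<in> set (path_edges (xs @ [p, z])). ce e = c" using split[of z] False by blast
    \<comment> \<open>If the endpoint also lies in \<open>C\<close>, the whole path stays inside
      \<open>C\<close> and therefore inside \<open>H\<close>.\<close>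
    have "e \<subseteq> C" if "e \<in> set (path_edges (xs @ [p, z]))" for e
      using path_edges_subset[OF that] xs(2) z by auto
    then have "graph_path V H y (xs @ [p, z]) z"
      using xs by (auto simp: graph_path_def H_def)
    then show ?thesis by (rule graph_path_imp_reachable)
  qed simp
  have "(y, z) \<in> (adj H)\<^sup>*" if z: "z \<in> V" for z
  proof (cases "z \<in> C")
    case False
    then have "(par z, z) \<in> adj H" using z by (auto simp: adj_def H_def)
    then show ?thesis using reachC[of "par z"] par z False
      by (meson DiffI rtrancl.rtrancl_into_rtrancl)
  qed (rule reachC)
  then have "connected_graph V H" using H.connected_if_reachable assms(2) by blast
  then obtain T where T: "T \<subseteq> H" "connected_graph V T" "card T + 1 = card V"
    using H.spanning_exists by blast
  interpret T: simple_graph V T by (rule H.subgraph[OF T(1)])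
  have TE: "T \<subseteq> E" using T HE by blast
  have "degree T z = 1" if z: "z \<in> V - C" for z
  proof (rule antisym)
    have "{e \<in> H. z \<in> e} \<subseteq> {{par z, z}}" using z par by (auto simp: H_def)
    then have "card {e \<in> H. z \<in> e} \<le> card {{par z, z}}" by (rule card_mono[rotated]) simp
    then have "degree H z \<le> 1" by (simp add: degree_def)
    then show "degree T z \<le> 1" using degree_mono[OF H.finite_edges T(1), of z] by simp
    show "1 \<le> degree T z" using T.degree_pos T(2) assms(1) z by blast
  qed
  then have "card (V - C) \<le> num_leaves V T"
    unfolding num_leaves_def by (intro card_mono) (use finite_vertices in auto)
  also have "\<dots> \<le> max_leaves V E"
    using num_leaves_le_max_leaves[OF TE] spanning_is_tree[OF TE] T by blast
  finally have L: "card (V - C) \<le> max_leaves V E" .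
  \<comment> \<open>Vertices in \<open>C\<close> and edges of \<open>T\<close> contribute only
    \<open>c\<close>.\<close>
  have "cv ` V \<union> ce ` E \<subseteq> {c} \<union> (cv ` (V - C) \<union> ce ` (E - T))"
    using Hc T(1) by (auto simp: C_def)
  then have "card (cv ` V \<union> ce ` E) \<le> card ({c} \<union> (cv ` (V - C) \<union> ce ` (E - T)))"
    by (rule card_mono[rotated]) (use finite_vertices finite_edges in auto)
  also have "\<dots> \<le> card {c} + card (cv ` (V - C) \<union> ce ` (E - T))" by (rule card_Un_le)
  also have "\<dots> \<le> 1 + (card (cv ` (V - C)) + card (ce ` (E - T)))"
    using card_Un_le[of "cv ` (V - C)"] by simp
  also have "\<dots> \<le> 1 + (card (V - C) + card (E - T))"
    by (intro add_mono card_image_le) (use finite_vertices finite_edges in auto)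
  finally have "card (cv ` V \<union> ce ` E) \<le> 1 + (max_leaves V E + card (E - T))" using L by simp
  moreover have "card (E - T) + card T = card E"
    using TE finite_edges by (metis T.finite_edges card_Diff_subset card_mono le_add_diff_inverse2)
  ultimately show ?thesis using T(3) by linarith
qed

text \<open>Every path from \<open>x\<close> to a third vertex starts with \<open>{x, y}\<close> and
  has \<open>y\<close> as an internal vertex. Its color is thus \<open>ce {x, y}\<close>, also at
  \<open>y\<close>, and dropping \<open>x\<close> leaves the path from \<open>y\<close> that a root
  requires.\<close>

lemma colors_le_if_pendant:
  assumes col: "tmc_coloring V E cv ce" and n: "card V \<ge> 3"
    and x: "x \<in> V" "degree E x = 1"
  shows "card (cv ` V \<union> ce ` E) + card V \<le> card E + 2 + max_leaves V E"
proof -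
  have "card {w. {x, w} \<in> E} = 1" using x degree_eq_card_neighbours by simp
  then obtain y where y: "{w. {x, w} \<in> E} = {y}" by (metis card_1_singletonE)
  then have xy: "{x, y} \<in> E" by auto
  have yV: "y \<in> V" "x \<noteq> y" using edge_vertices[OF xy] by auto
  let ?c = "ce {x, y}"
  have main: "cv y = ?c \<and> (\<exists>xs. graph_path V E y xs z \<and>
        (\<forall>e \<in> set (path_edges xs). ce e = ?c) \<and> (\<forall>w \<in> set (internal_vertices xs). cv w = ?c))"
    if z: "z \<in> V" "z \<noteq> x" "z \<noteq> y" for z
  proof -
    obtain xs k where xs: "graph_path V E x xs z" "\<forall>e \<in> set (path_edges xs). ce e = k"
      "\<forall>w \<in> set (internal_vertices xs). cv w = k"
      using col x z unfolding tmc_coloring_def total_mono_path_def by blast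
    obtain a b ys where ys: "xs = a # b # ys" using xs(1) z
      by (cases xs rule: path_edges.cases) (auto simp: graph_path_def)
    have "a = x" "{x, b} \<in> E" using xs(1) by (auto simp: graph_path_def ys)
    then have "b = y" using y by blast
    have "ys \<noteq> []" using xs(1) z \<open>b = y\<close> by (auto simp: graph_path_def ys)
    have k: "k = ?c" using xs(2) by (simp add: ys \<open>a = x\<close> \<open>b = y\<close>)
    have "cv y = ?c" using xs(3) \<open>ys \<noteq> []\<close> k by (auto simp: ys \<open>b = y\<close> internal_vertices_def)
    moreover have "graph_path V E y (y # ys) z"
      using graph_path_suffix[of V E x "[a]" b ys z] xs(1) by (simp add: ys \<open>b = y\<close>)
    moreover have "\<forall>w \<in> set (internal_vertices (y # ys)). cv w = ?c"
      using xs(3) k \<open>ys \<noteq> []\<close> by (auto simp: ys \<open>b = y\<close> internal_vertices_def)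
    moreover have "\<forall>e \<in> set (path_edges (y # ys)). ce e = ?c"
      using xs(2) k by (simp add: ys \<open>b = y\<close>)
    ultimately show ?thesis by blast
  qed
  \<comment> \<open>A third vertex is what forces the color of \<open>y\<close>.\<close>
  have "\<not> V \<subseteq> {x, y}"
  proof
    assume "V \<subseteq> {x, y}"
    then have "card V \<le> card {x, y}" by (rule card_mono[rotated]) simp
    then show False using n yV by simp
  qed
  then have c: "cv y = ?c" using main by blast
  \<comment> \<open>The remaining target \<open>x\<close> is reached by one edge, with no internal
    vertex to check.\<close>
  have "graph_path V E y [y, x] x" using xy yV x by (simp add: graph_path_def insert_commute)
  moreover have "\<forall>e \<in> set (path_edges [y, x]). ce e = ?c" by (simp add: insert_commute)
  moreover have "\<forall>w \<in> set (internal_vertices [y, x]). cv w = ?c" by (simp add: internal_vertices_def)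
  ultimately show ?thesis
    using colors_le_if_rooted[of y cv ?c ce] main c n yV(1) by (metis One_nat_def Suc_leD numeral_2_eq_2 numeral_3_eq_3)
qed

lemma colors_le_if_2_regular:
  assumes col: "tmc_coloring V E cv ce" and n: "card V \<ge> 2"
    and reg: "\<And>v. v \<in> V \<Longrightarrow> degree E v = 2"
    and uw: "u \<in> V" "w \<in> V" "u \<noteq> w" "{u, w} \<notin> E"
  shows "card (cv ` V \<union> ce ` E) + card V \<le> card E + 2 + max_leaves V E"
proof -
  obtain xs c where xs: "graph_path V E u xs w" "\<forall>e \<in> set (path_edges xs). ce e = c"
      "\<forall>w \<in> set (internal_vertices xs). cv w = c"
    using col uw unfolding tmc_coloring_def total_mono_path_def by blast
  \<comment> \<open>Since \<open>u\<close> and \<open>w\<close> are distinct and nonadjacent, the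
    path has an internal vertex.\<close>
  obtain y where y: "y \<in> set (internal_vertices xs)"
    using xs(1) uw
    by (cases xs rule: path_edges.cases)
      (auto simp: graph_path_def internal_vertices_def split: if_splits)
  obtain a b where ab: "a \<noteq> b" "{a, y} \<in> E" "{b, y} \<in> E"
    "{a, y} \<in> set (path_edges xs)" "{b, y} \<in> set (path_edges xs)"
    using graph_path_edges_around[OF xs(1) y] by metis
  have yV: "y \<in> V" using edge_vertices[OF ab(2)] by simp
  have "{a, y} \<noteq> {b, y}" using ab(1) by (auto simp: doubleton_eq_iff)
  then have "card {e \<in> E. y \<in> e} \<le> card {{a, y}, {b, y}}"
    using reg[OF yV] by (simp add: degree_def)
  moreover have "{{a, y}, {b, y}} \<subseteq> {e \<in> E. y \<in> e}" using ab(2,3) by simp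
  ultimately have at: "{{a, y}, {b, y}} = {e \<in> E. y \<in> e}"
    using finite_edges by (intro card_seteq) simp_all
  \<comment> \<open>By 2-regularity the two path edges at \<open>y\<close> are all its
    edges.\<close>
  have at_y: "ce e = c" if "e \<in> E" "y \<in> e" for e
  proof -
    have "e \<in> {{a, y}, {b, y}}" unfolding at using that by simp
    then show ?thesis using xs(2) ab(4,5) by (metis insertE singletonD)
  qed
  have "\<exists>ys. graph_path V E y ys z \<and>
        (\<forall>e \<in> set (path_edges ys). ce e = c) \<and> (\<forall>w \<in> set (internal_vertices ys). cv w = c)"
    if z: "z \<in> V" "z \<noteq> y" for z
  proof -
    obtain ys k where ys: "graph_path V E y ys z" "\<forall>e \<in> set (path_edges ys). ce e = k"
      "\<forall>w \<in> set (internal_vertices ys). cv w = k"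
      using col yV z unfolding tmc_coloring_def total_mono_path_def by blast
    \<comment> \<open>The first edge of any path leaving \<open>y\<close> has color
      \<open>c\<close>, so the whole path does.\<close>
    obtain p zs where "ys = y # p # zs" using ys(1) z
      by (cases ys rule: path_edges.cases) (auto simp: graph_path_def)
    then have "k = c" using at_y[of "{y, p}"] ys by (simp add: graph_path_def)
    then show ?thesis using ys by blast
  qed
  then show ?thesis using colors_le_if_rooted[of y cv c ce] n yV xs(3) y by blast
qed

section \<open>Leaves and vertex degrees\<close>

lemma num_leaves_degree_sum:
  assumes "is_tree V E" "card V \<ge> 2"
  shows "num_leaves V E = 2 + (\<Sum>v\<in>V. degree E v - 2)"
proof -
  have t: "connected_graph V E" "card E + 1 = card V" using assms is_tree_iff by auto
  \<comment> \<open>Truncated subtraction gives 0 at a leaf, where the indicator supplies the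
    missing 1. Summing and using the degree sum 2(n - 1) yields the formula.\<close>
  have "(\<Sum>v\<in>V. degree E v + (if degree E v = 1 then 1 else 0)) = (\<Sum>v\<in>V. 2 + (degree E v - 2))"
  proof (rule sum.cong)
    fix v assume "v \<in> V"
    then have "degree E v \<ge> 1" using degree_pos t(1) assms(2) by blast
    then show "degree E v + (if degree E v = 1 then 1 else 0) = 2 + (degree E v - 2)" by auto
  qed simp
  moreover have "(\<Sum>v\<in>V. (if degree E v = 1 then 1 else 0)) = num_leaves V E"
    unfolding num_leaves_def using finite_vertices by (simp add: sum.If_cases Int_def)
  moreover have "(\<Sum>v\<in>V. 2) = 2 * card V" by simp
  ultimately show ?thesis using sum_degree t(2) unfolding sum.distrib by linarith
qed

text \<open>The average degree exceeds 2, so some vertex has three neighbors. Extending its full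
  star to a spanning tree keeps that degree, and the leaf formula then gives a third leaf.\<close>

lemma max_leaves_ge_3:
  assumes c: "connected_graph V E" and m: "card E > card V"
  shows "max_leaves V E \<ge> 3"
proof -
  have "\<exists>v\<in>V. degree E v \<ge> 3"
  proof (rule ccontr)
    assume "\<not> ?thesis"
    then have "(\<Sum>v\<in>V. degree E v) \<le> (\<Sum>v\<in>V. 2)" by (intro sum_mono) force
    then show False using sum_degree m by simp
  qed
  then obtain v where v: "v \<in> V" "degree E v \<ge> 3" by blast
  define N where "N = {w. {v, w} \<in> E}"
  define T0 where "T0 = (\<lambda>w. {v, w}) ` N"
  have N: "N \<subseteq> V" "v \<notin> N" unfolding N_def using edge_vertices by blast+
  then have fN: "finite N" using finite_vertices finite_subset by blast
  have cN: "card N = degree E v" by (simp add: N_def degree_eq_card_neighbours)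
  have cT0: "card T0 = card N" unfolding T0_def
    by (rule card_image) (auto simp: inj_on_def doubleton_eq_iff)
  have "(v, w) \<in> (adj T0)\<^sup>*" if "w \<in> insert v N" for w
    using that by (auto simp: adj_def T0_def)
  moreover have "insert v N \<subseteq> V" "T0 \<subseteq> E" "\<Union>T0 \<subseteq> insert v N"
    using N v(1) by (auto simp: T0_def N_def)
  moreover have "card T0 + 1 = card (insert v N)" using N(2) fN cT0 by simp
  ultimately obtain T where T: "T0 \<subseteq> T" "T \<subseteq> E" "connected_graph V T" "card T + 1 = card V"
    using extend_to_spanning[OF c, of "insert v N" v T0] by auto
  interpret T: simple_graph V T by (rule subgraph[OF T(2)])
  have "T0 \<subseteq> {e \<in> T. v \<in> e}" using T(1) by (auto simp: T0_def)
  then have "card T0 \<le> degree T v" unfolding degree_def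
    by (rule card_mono[rotated]) (simp add: T.finite_edges)
  then have "1 \<le> degree T v - 2" using cT0 cN v by simp
  also have "\<dots> \<le> (\<Sum>v\<in>V. degree T v - 2)"
    by (rule member_le_sum) (use v finite_vertices in auto)
  finally have *: "1 \<le> (\<Sum>v\<in>V. degree T v - 2)" .
  have "card V \<ge> 2"
    using cN v(2) card_mono[OF finite_vertices N(1)] by linarith
  moreover have tree: "is_tree V T" using spanning_is_tree T by blast
  ultimately have "num_leaves V T \<ge> 3" using T.num_leaves_degree_sum * by simp
  then show ?thesis using num_leaves_le_max_leaves[OF T(2) tree] by simp
qed

text \<open>Degrees cannot grow in a spanning tree, so every excess term of the leaf formula
  vanishes.\<close>

lemma max_leaves_eq_2_if_2_regular:
  assumes c: "connected_graph V E" and n: "card V \<ge> 2"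
    and reg: "\<And>v. v \<in> V \<Longrightarrow> degree E v = 2"
  shows "max_leaves V E = 2"
proof -
  obtain T where T: "T \<subseteq> E" "is_tree V T" "num_leaves V T = max_leaves V E"
    using max_leaves_attained[OF c] .
  interpret T: simple_graph V T by (rule subgraph[OF T(1)])
  have "degree T v - 2 = 0" if "v \<in> V" for v
    using degree_mono[OF finite_edges T(1), of v] reg[OF that] by simp
  then show ?thesis using T.num_leaves_degree_sum[OF T(2) n] T(3) by simp
qed

text \<open>Single edges have no internal vertices, so all vertices and edges may have different
  colors.\<close>

lemma tmc_ge_complete:
  assumes "\<And>u v. u \<in> V \<Longrightarrow> v \<in> V \<Longrightarrow> u \<noteq> v \<Longrightarrow> {u, v} \<in> E"
  shows "tmc V E \<ge> card V + card E"
proof -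
  obtain f :: "'a \<Rightarrow> nat" where f: "inj_on f V"
    using finite_imp_inj_to_nat_seg[OF finite_vertices] by blast
  obtain g :: "'a set \<Rightarrow> nat" where g: "inj_on g E"
    using finite_imp_inj_to_nat_seg[OF finite_edges] by blast
  let ?cv = "\<lambda>v. 2 * f v" and ?ce = "\<lambda>e. 2 * g e + 1"
  have "\<exists>xs. total_mono_path V E ?cv ?ce u xs v" if uv: "u \<in> V" "v \<in> V" for u v
  proof (cases "u = v")
    case True
    then show ?thesis using uv
      by (intro exI[of _ "[u]"]) (simp add: total_mono_path_def graph_path_def internal_vertices_def)
  next
    case False
    then show ?thesis using uv assms[OF uv False]
      by (intro exI[of _ "[u, v]"]) (simp add: total_mono_path_def graph_path_def internal_vertices_def)
  qed
  then have "tmc_coloring V E ?cv ?ce" by (simp add: tmc_coloring_def)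
  then have "card (?cv ` V \<union> ?ce ` E) \<le> tmc V E" by (rule card_colors_le_tmc)
  moreover have "?cv ` V \<inter> ?ce ` E = {}" by auto presburger
  moreover have "card (?cv ` V) = card V" by (rule card_image) (use f in \<open>auto simp: inj_on_def\<close>)
  moreover have "card (?ce ` E) = card E" by (rule card_image) (use g in \<open>auto simp: inj_on_def\<close>)
  ultimately show ?thesis using finite_vertices finite_edges by (simp add: card_Un_disjoint)
qed

lemma max_leaves_le_card:
  assumes "connected_graph V E"
  shows "max_leaves V E \<le> card V"
proof -
  obtain T where "num_leaves V T = max_leaves V E" using max_leaves_attained[OF assms] .
  moreover have "num_leaves V T \<le> card V"
    unfolding num_leaves_def by (rule card_mono) (use finite_vertices in auto)
  ultimately show ?thesis by simp
qed

lemma complete_2_regular: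
  assumes "V \<noteq> {}" "\<And>u v. u \<in> V \<Longrightarrow> v \<in> V \<Longrightarrow> u \<noteq> v \<Longrightarrow> {u, v} \<in> E"
    and "\<And>v. v \<in> V \<Longrightarrow> degree E v = 2"
  shows "card V = 3"
proof -
  obtain v where v: "v \<in> V" using assms(1) by blast
  have "{w. {v, w} \<in> E} = V - {v}" using assms(2) v edge_vertices by blast
  then have "card (V - {v}) = 2" using assms(3)[OF v] degree_eq_card_neighbours by simp
  then show ?thesis using v finite_vertices by simp
qed

section \<open>Case analysis on order, size and degrees\<close>

lemma tmc_eq_5_iff:
  assumes c: "connected_graph V E"
  shows "tmc V E = 5 \<longleftrightarrow>
    (is_tree V E \<and> max_leaves V E = 4) \<or> (unicyclic V E \<and> max_leaves V E = 3)"
proof (cases "card V \<le> 2")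
  case True
  \<comment> \<open>At most one edge exists, hence at most three colors and two leaves: both sides
    fail.\<close>
  have "E \<subseteq> {V}"
  proof
    fix e assume e: "e \<in> E"
    have "e = V"
      by (rule card_seteq) (use finite_vertices edge_subset[OF e] card_edge[OF e] True in auto)
    then show "e \<in> {V}" by simp
  qed
  then have "card E \<le> 1" using card_mono[of "{V}" E] by simp
  moreover obtain cv ce where "tmc_coloring V E cv ce" "card (cv ` V \<union> ce ` E) = tmc V E"
    using tmc_attained[OF c] .
  ultimately have "tmc V E \<noteq> 5" using card_colors_le[of cv ce] True by linarith
  moreover have "max_leaves V E \<le> 2" using max_leaves_le_card[OF c] True by simp
  ultimately show ?thesis by auto
next
  case False
  then have n: "card V \<ge> 3" "card V \<ge> 2" by auto
  have lb: "card E + 2 + max_leaves V E \<le> tmc V E + card V" using tmc_ge c n by blast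
  have tree: "is_tree V E \<longleftrightarrow> card E + 1 = card V" using is_tree_iff c by simp
  have uni: "unicyclic V E \<longleftrightarrow> card E = card V" using c by (simp add: unicyclic_def)
  obtain cv ce where col: "tmc_coloring V E cv ce" "card (cv ` V \<union> ce ` E) = tmc V E"
    using tmc_attained[OF c] .
  show ?thesis
  proof (cases "card E > card V")
    case True
    \<comment> \<open>Here m - n + 2 + l is at least 6, and the graph is neither a tree nor
      unicyclic.\<close>
    then show ?thesis using max_leaves_ge_3[OF c] lb tree uni by linarith
  next
    case m: False
    show ?thesis
    proof (cases "\<exists>x\<in>V. degree E x = 1")
      case True
      then have "tmc V E + card V \<le> card E + 2 + max_leaves V E"
        using colors_le_if_pendant col n by metis
      \<comment> \<open>Now \<open>tmc\<close> equals m - n + 2 + l with m = n - 1 or m = n, so the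
        value 5 means l = 4 or l = 3 respectively.\<close>
      then show ?thesis using lb tree uni m connected_card[OF c] by linarith
    next
      case False
      then have ge: "degree E v \<ge> 2" if "v \<in> V" for v
        using degree_pos[OF c n(2) that] that by force
      \<comment> \<open>Degrees at least 2 with sum at most 2n must all equal 2.\<close>
      have le: "(\<Sum>v\<in>V. degree E v) \<le> (\<Sum>v\<in>V. 2)" using sum_degree m by simp
      have reg: "degree E v = 2" if v: "v \<in> V" for v
      proof (rule ccontr)
        assume "degree E v \<noteq> 2"
        then have "(\<Sum>v\<in>V. 2) < (\<Sum>v\<in>V. degree E v)"
          using ge v finite_vertices by (intro sum_strict_mono_ex1) force+
        then show False using le by simp
      qed
      then have mn: "card E = card V" using sum_degree by simp
      have l: "max_leaves V E = 2" using max_leaves_eq_2_if_2_regular[OF c n(2) reg] .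
      have "tmc V E \<noteq> 5"
      proof (cases "\<forall>u\<in>V. \<forall>v\<in>V. u \<noteq> v \<longrightarrow> {u, v} \<in> E")
        case True
        \<comment> \<open>The triangle has 3 + 3 objects, all of which can be colored differently,
          so \<open>tmc\<close> is at least 6.\<close>
        then have "card V = 3" using complete_2_regular reg n by fastforce
        then show ?thesis using tmc_ge_complete True mn by fastforce
      next
        case False
        then obtain u w where "u \<in> V" "w \<in> V" "u \<noteq> w" "{u, w} \<notin> E" by blast
        \<comment> \<open>With m = n and l = 2 this bound is 4.\<close>
        then have "tmc V E + card V \<le> card E + 2 + max_leaves V E"
          using colors_le_if_2_regular[OF col(1) n(2) reg] col(2) by metis
        then show ?thesis using l mn by simp
      qed
      then show ?thesis using l tree mn by simp
    qed
  qed
qed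

end

theorem theorem5:
  fixes V :: "'a set" and E :: "'a set set"
  assumes "simple_graph V E"
    and "connected_graph V E"
  shows "tmc V E = 5 \<longleftrightarrow>
    (is_tree V E \<and> max_leaves V E = 4) \<or> (unicyclic V E \<and> max_leaves V E = 3)"
  using simple_graph.tmc_eq_5_iff[OF assms] .

end
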